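(* Let $h\ge 2$. For $d=2$ and for every odd $d\ge 3$, $\#\mathrm{BWpebbles}(T^h_d)=\lceil (d-1)h/2\rceil+1$, and for odd $d$ this value is unchanged if white sliding moves are additionally allowed. For every even $d\ge 2$, $\#\mathrm{BWpebbles}(T^h_d)\le\lceil (d-1)h/2\rceil+1$.
   Context: $T^h_d$ is the balanced rooted $d$-ary tree with $h$ levels (height counts levels). A whole black-white pebble configuration assigns to each node $i$ values $b(i),w(i)\in\{0,1\}$ with $b(i)+w(i)\le1$ (a black pebble, a white pebble, or none); the number of pebbles is the total number of pebbled nodes. Moves: (i) remove a black pebble from any node; (ii) place a white pebble on any empty node; (iii) if every child of node $i$ carries a pebble (black or white; vacuous for leaves), then remove the white pebble from $i$ (if any) and/or place a black pebble on $i$, simultaneously removing any black pebbles from children of $i$ (black sliding). A black-white pebbling with $p$ pebbles starts and ends with no pebbles, has a black pebble on the root at some point, and never has more than $p$ pebbles. $\#\mathrm{BWpebbles}(T)$ is the minimum such $p$. A white sliding move, when allowed, is: if $i$ carries a white pebble and every child of $i$ except one child $j$ carries a pebble, move the white pebble from $i$ to $j$. *)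

theory Defs
  imports Complex_Main
begin

record 'v rooted_tree =
  nodes :: "'v set"
  root :: 'v
  children :: "'v \<Rightarrow> 'v set"

text \<open>
  In the balanced \<open>d\<close>-ary tree with \<open>h\<close> levels, a node is named by the path leading to it from
  the root \<open>[]\<close>; a node of length \<open>l\<close> lies on level \<open>l + 1\<close> counted from the root, so the nodes
  of length \<open>h - 1\<close> are the leaves.
\<close>

definition balanced_tree :: "nat \<Rightarrow> nat \<Rightarrow> nat list rooted_tree" where
  "balanced_tree d h =
     \<lparr> nodes = {v. length v < h \<and> set v \<subseteq> {..<d}},
       root = [],
       children = (\<lambda>v. {v @ [c] | c. c < d \<and> Suc (length v) < h}) \<rparr>"

text \<open>
  A whole black-white pebble configuration is a pair \<open>(B, W)\<close>: \<open>B\<close> is the set of nodes \<open>i\<close> with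
  \<open>b(i) = 1\<close> and \<open>W\<close> the set of nodes \<open>i\<close> with \<open>w(i) = 1\<close>. The condition \<open>b(i) + w(i) \<le> 1\<close> is
  disjointness.
\<close>

type_synonym 'v bw_config = "'v set \<times> 'v set"

definition is_bw_config :: "('v, 'm) rooted_tree_scheme \<Rightarrow> 'v bw_config \<Rightarrow> bool" where
  "is_bw_config T C \<longleftrightarrow> fst C \<subseteq> nodes T \<and> snd C \<subseteq> nodes T \<and> fst C \<inter> snd C = {}"

definition num_pebbles :: "'v bw_config \<Rightarrow> nat" where
  "num_pebbles C = card (fst C) + card (snd C)"

text \<open>
  The last two rules are the two options of move (iii); \<open>R\<close> is the set of children from which
  black pebbles are taken away in the same move (any subset is allowed). Placing a black pebble on
  \<open>i\<close> removes a white pebble on \<open>i\<close>, since a node cannot carry both.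
\<close>

inductive bw_move :: "('v, 'm) rooted_tree_scheme \<Rightarrow> 'v bw_config \<Rightarrow> 'v bw_config \<Rightarrow> bool"
  for T :: "('v, 'm) rooted_tree_scheme" where
  remove_black: "i \<in> B \<Longrightarrow> bw_move T (B, W) (B - {i}, W)"
| place_white: "i \<in> nodes T \<Longrightarrow> i \<notin> B \<union> W \<Longrightarrow> bw_move T (B, W) (B, insert i W)"
| remove_white: "i \<in> nodes T \<Longrightarrow> children T i \<subseteq> B \<union> W \<Longrightarrow> R \<subseteq> children T i
    \<Longrightarrow> bw_move T (B, W) (B - R, W - {i})"
| place_black: "i \<in> nodes T \<Longrightarrow> children T i \<subseteq> B \<union> W \<Longrightarrow> R \<subseteq> children T i
    \<Longrightarrow> bw_move T (B, W) (insert i (B - R), W - {i})"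

inductive white_slide :: "('v, 'm) rooted_tree_scheme \<Rightarrow> 'v bw_config \<Rightarrow> 'v bw_config \<Rightarrow> bool"
  for T :: "('v, 'm) rooted_tree_scheme" where
  "i \<in> W \<Longrightarrow> j \<in> children T i \<Longrightarrow> j \<notin> B \<union> W \<Longrightarrow> children T i - {j} \<subseteq> B \<union> W
    \<Longrightarrow> white_slide T (B, W) (B, insert j (W - {i}))"

definition bw_move_ws :: "('v, 'm) rooted_tree_scheme \<Rightarrow> 'v bw_config \<Rightarrow> 'v bw_config \<Rightarrow> bool" where
  "bw_move_ws T C C' \<longleftrightarrow> bw_move T C C' \<or> white_slide T C C'"

definition bw_pebbling ::
  "('v, 'm) rooted_tree_scheme \<Rightarrow> ('v bw_config \<Rightarrow> 'v bw_config \<Rightarrow> bool) \<Rightarrow> nat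
     \<Rightarrow> 'v bw_config list \<Rightarrow> bool" where
  "bw_pebbling T move p cs \<longleftrightarrow>
     cs \<noteq> [] \<and> hd cs = ({}, {}) \<and> last cs = ({}, {}) \<and> successively move cs \<and>
     (\<exists>C \<in> set cs. root T \<in> fst C) \<and>
     (\<forall>C \<in> set cs. is_bw_config T C \<and> num_pebbles C \<le> p)"

definition BWpebbles :: "('v, 'm) rooted_tree_scheme \<Rightarrow> nat" where
  "BWpebbles T = (LEAST p. \<exists>cs. bw_pebbling T (bw_move T) p cs)"

definition BWpebbles_ws :: "('v, 'm) rooted_tree_scheme \<Rightarrow> nat" where
  "BWpebbles_ws T = (LEAST p. \<exists>cs. bw_pebbling T (bw_move_ws T) p cs)"

text \<open>The minima above are attained for balanced trees: there always is some pebbling.\<close>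

lemma finite_nodes_balanced_tree: "finite (nodes (balanced_tree d h))"
proof -
  have "nodes (balanced_tree d h) \<subseteq> {v. set v \<subseteq> {..<d} \<and> length v \<le> h}"
    by (auto simp: balanced_tree_def)
  then show ?thesis
    by (rule finite_subset) (simp add: finite_lists_length_le)
qed

lemma bw_pebbling_exists:
  assumes "h \<ge> 1"
  shows "\<exists>p cs. bw_pebbling (balanced_tree d h) (bw_move (balanced_tree d h)) p cs"
proof -
  let ?T = "balanced_tree d h"
  define V where "V = nodes ?T"
  have fin: "finite V" unfolding V_def by (rule finite_nodes_balanced_tree)
  define ok :: "nat list bw_config list \<Rightarrow> bool" where
    "ok cs \<longleftrightarrow> cs \<noteq> [] \<and> successively (bw_move ?T) cs \<and> (\<forall>C \<in> set cs. fst C \<subseteq> V \<and> snd C = {})"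
    for cs
  have up: "\<exists>cs. ok cs \<and> hd cs = ({}, {}) \<and> last cs = (S, {})"
    if "S \<subseteq> V" "\<forall>v \<in> S. children ?T v \<subseteq> S" for S
    using that
  proof (induction "card S" arbitrary: S)
    case 0
    then have "S = {}" using fin finite_subset by fastforce
    then show ?case by (intro exI[of _ "[({}, {})]"]) (auto simp: ok_def)
  next
    case (Suc n)
    have finS: "finite S" and "S \<noteq> {}" using Suc fin finite_subset by fastforce+
    define i where "i = arg_min_on length S"
    have iS: "i \<in> S" and imin: "length i \<le> length v" if "v \<in> S" for v
      using arg_min_if_finite[OF finS \<open>S \<noteq> {}\<close>, of length] that
      unfolding i_def by (auto simp: not_less)
    have i: "i \<in> S" using iS \<open>S \<noteq> {}\<close> by blast
    have not_child: "i \<notin> children ?T v" if "v \<in> S" for v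
      using imin[OF that] by (auto simp: balanced_tree_def)
    have "\<exists>cs. ok cs \<and> hd cs = ({}, {}) \<and> last cs = (S - {i}, {})"
    proof (rule Suc.hyps(1))
      show "n = card (S - {i})" using Suc.hyps(2) i finS by simp
      show "S - {i} \<subseteq> V" using Suc.prems(1) by blast
      show "\<forall>v \<in> S - {i}. children ?T v \<subseteq> S - {i}" using Suc.prems(2) not_child by blast
    qed
    then obtain cs where cs: "ok cs" "hd cs = ({}, {})" "last cs = (S - {i}, {})" by blast
    have "bw_move ?T (S - {i}, {}) (insert i (S - {i} - {}), {} - {i})"
      using Suc.prems i not_child[OF i] by (intro bw_move.place_black) (auto simp: V_def)
    then have "bw_move ?T (S - {i}, {}) (S, {})" using i by (simp add: insert_absorb)
    then have "ok (cs @ [(S, {})])"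
      using cs Suc.prems(1) by (auto simp: ok_def successively_append_iff)
    then show ?case using cs by (intro exI[of _ "cs @ [(S, {})]"]) (auto simp: ok_def)
  qed
  have down: "\<exists>cs. ok cs \<and> hd cs = (S, {}) \<and> last cs = ({}, {})" if "S \<subseteq> V" for S
    using finite_subset[OF that fin] that
  proof (induction S rule: finite_induct)
    case empty
    show ?case by (intro exI[of _ "[({}, {})]"]) (auto simp: ok_def)
  next
    case (insert i S)
    then obtain cs where cs: "ok cs" "hd cs = (S, {})" "last cs = ({}, {})" by blast
    have "bw_move ?T (insert i S, {}) (insert i S - {i}, {})" by (rule bw_move.remove_black) simp
    then have "bw_move ?T (insert i S, {}) (S, {})" using insert.hyps by simp
    then have "ok ((insert i S, {}) # cs)"
      using cs insert.prems by (cases cs) (auto simp: ok_def)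
    then show ?case using cs by (intro exI[of _ "(insert i S, {}) # cs"]) (auto simp: ok_def)
  qed
  obtain us where us: "ok us" "hd us = ({}, {})" "last us = (V, {})"
  proof -
    have "\<forall>v \<in> V. children ?T v \<subseteq> V" by (auto simp: V_def balanced_tree_def)
    then show ?thesis using up[of V] that by blast
  qed
  obtain ds where ds: "ok ds" "hd ds = (V, {})" "last ds = ({}, {})"
    using down[of V] by blast
  have stay: "bw_move ?T (V, {}) (V, {})"
  proof -
    have "[] \<in> V" using assms by (simp add: V_def balanced_tree_def)
    moreover have "children ?T [] \<subseteq> V \<union> {}" by (auto simp: V_def balanced_tree_def assms)
    ultimately have "bw_move ?T (V, {}) (V - {}, {} - {[]})"
      by (intro bw_move.remove_white) (auto simp: V_def)
    then show ?thesis by simp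
  qed
  have all: "ok (us @ ds)" using us ds stay by (auto simp: ok_def successively_append_iff)
  have "(V, {}) \<in> set (us @ ds)" using us by (metis Un_iff last_in_set ok_def set_append)
  moreover have "root ?T \<in> V" using assms by (simp add: V_def balanced_tree_def)
  moreover have "num_pebbles C \<le> card V" if "C \<in> set (us @ ds)" for C
    using all that fin card_mono[of V "fst C"] by (auto simp: ok_def num_pebbles_def)
  ultimately have "bw_pebbling ?T (bw_move ?T) (card V) (us @ ds)"
    using all us ds unfolding bw_pebbling_def is_bw_config_def ok_def
    by (force simp: V_def)
  then show ?thesis by blast
qed

lemma bw_pebbling_ws_exists:
  assumes "h \<ge> 1"
  shows "\<exists>p cs. bw_pebbling (balanced_tree d h) (bw_move_ws (balanced_tree d h)) p cs"
proof -
  obtain p cs where "bw_pebbling (balanced_tree d h) (bw_move (balanced_tree d h)) p cs"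
    using bw_pebbling_exists[OF assms] by blast
  then have "bw_pebbling (balanced_tree d h) (bw_move_ws (balanced_tree d h)) p cs"
    unfolding bw_pebbling_def by (auto simp: bw_move_ws_def elim: successively_mono)
  then show ?thesis by blast
qed

end

theory Submission
  imports Defs
begin

text \<open>
  Upper bound. To pebble a node with \<open>l + 1 + r\<close> children, leave black pebbles on the \<open>l\<close> left children,
  play the middle subtree until its root becomes black, guess white pebbles on the \<open>r\<close> right children,
  move the black pebble up, finish the middle subtree and then justify the white pebbles one by one. For
  odd \<open>d\<close> take \<open>l = r\<close>; for even \<open>d\<close> the two possible roundings alternate with the height.

  Lower bound, odd \<open>d = 2m + 1\<close>. At some time \<open>t\<close> all children of the node are pebbled. Around \<open>t\<close> each
  child subtree goes through a phase from empty to empty, and by induction it has a peak of \<open>q\<close> pebbles in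
  this phase. At least \<open>m + 1\<close> of the peaks lie on the same side of \<open>t\<close>; at the one closest to \<open>t\<close> the
  other \<open>m\<close> subtrees are nonempty. So every level costs \<open>m\<close> more pebbles.

  Lower bound, \<open>d = 2\<close>. The same argument shows that if \<open>q\<close> pebbles sufficed, the two peaks would lie on
  different sides of \<open>t\<close>, and the subtree with the late peak would hold fewer than \<open>q\<close> pebbles up to \<open>t\<close>.
  Without white sliding this forces more than \<open>q\<close> pebbles in that subtree, by looking one level further
  down. So every two levels cost one more pebble.
\<close>

section \<open>Lower bounds\<close>

definition pebbled :: "'v bw_config \<Rightarrow> 'v set" where
  "pebbled C = fst C \<union> snd C"

definition below :: "nat list \<Rightarrow> nat list set" where
  "below v = {v @ w | w. True}"

definition load :: "nat list bw_config \<Rightarrow> nat list \<Rightarrow> nat" where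
  "load C v = card (pebbled C \<inter> below v)"

lemma in_below_self [simp]: "v \<in> below v"
  by (simp add: below_def)

lemma below_child_subset: "below (v @ [c]) \<subseteq> below v"
  by (auto simp: below_def)

lemma not_in_below_child [simp]: "v \<notin> below (v @ [c])"
  by (auto simp: below_def)

lemma below_children_disjoint: "c \<noteq> c' \<Longrightarrow> below (v @ [c]) \<inter> below (v @ [c']) = {}"
  by (auto simp: below_def)

lemma sum_load_children_le:
  assumes "finite (pebbled C)" "finite J"
  shows "(\<Sum>c\<in>J. load C (v @ [c])) \<le> load C v"
proof -
  have "(\<Sum>c\<in>J. load C (v @ [c])) = card (\<Union>c\<in>J. pebbled C \<inter> below (v @ [c]))"
    unfolding load_def using assms below_children_disjoint
    by (intro card_UN_disjoint[symmetric]) blast+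
  also have "\<dots> \<le> load C v"
    unfolding load_def using assms below_child_subset by (intro card_mono) auto
  finally show ?thesis .
qed

text \<open>Deleting \<open>v\<close> leaves the loads of its children alone and lowers its own load
  by one, so the plain sum bound applies to the rest. Since \<open>load\<close> ignores colours,
  \<open>?C\<close> is simply taken all black.\<close>

lemma load_child_Suc_le:
  assumes "finite (pebbled C)" "finite J" "v \<in> pebbled C"
  shows "Suc (\<Sum>c\<in>J. load C (v @ [c])) \<le> load C v"
proof -
  let ?C = "(pebbled C - {v}, {})"
  have "(\<Sum>c\<in>J. load C (v @ [c])) = (\<Sum>c\<in>J. load ?C (v @ [c]))"
  proof (rule sum.cong)
    fix c
    have "pebbled ?C \<inter> below (v @ [c]) = pebbled C \<inter> below (v @ [c])"
      by (auto simp: pebbled_def)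
    then show "load C (v @ [c]) = load ?C (v @ [c])" by (simp add: load_def)
  qed simp
  also have "\<dots> \<le> load ?C v"
    using assms by (intro sum_load_children_le) (auto simp: pebbled_def)
  also have "Suc \<dots> = load C v"
  proof -
    have "pebbled C \<inter> below v = insert v (pebbled ?C \<inter> below v)"
      using assms(3) by (auto simp: pebbled_def)
    then show ?thesis
      using assms(1) by (simp add: load_def) (simp add: pebbled_def)
  qed
  finally show ?thesis by simp
qed

section \<open>Changes of a property over discrete time\<close>

lemma first_change:
  fixes a b :: nat
  assumes "P a" "\<not> P b" "a \<le> b"
  obtains k where "a \<le> k" "k < b" "\<And>i. a \<le> i \<Longrightarrow> i \<le> k \<Longrightarrow> P i" "\<not> P (Suc k)"
proof -
  define e where "e = (LEAST i. a \<le> i \<and> \<not> P i)"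
  have e: "a \<le> e" "\<not> P e" "e \<le> b"
    unfolding e_def using LeastI[of "\<lambda>i. a \<le> i \<and> \<not> P i" b] assms
    by (auto intro: Least_le)
  have lt: "P i" if "a \<le> i" "i < e" for i
    using not_less_Least[of i "\<lambda>i. a \<le> i \<and> \<not> P i"] that unfolding e_def by blast
  have "e \<noteq> a" using e assms by auto
  then obtain k where "e = Suc k" "a \<le> k" using e by (cases e) auto
  then show thesis using that[of k] e lt by auto
qed

lemma maximal_interval:
  fixes a b t :: nat
  assumes "\<not> P a" "\<not> P b" "P t" "a \<le> t" "t \<le> b"
  obtains s e where "a \<le> s" "s < t" "t < e" "e \<le> b" "\<not> P s" "\<not> P e"
    "\<And>i. s < i \<Longrightarrow> i < e \<Longrightarrow> P i"
proof -
  obtain k where k: "t \<le> k" "k < b" "\<And>i. t \<le> i \<Longrightarrow> i \<le> k \<Longrightarrow> P i" "\<not> P (Suc k)"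
    using first_change[of P t b] assms by blast
  \<comment> \<open>The left end comes from the same lemma in reversed time, counting steps back
    from \<open>t\<close>.\<close>
  obtain j where j: "0 \<le> j" "j < t - a" "\<And>i. 0 \<le> i \<Longrightarrow> i \<le> j \<Longrightarrow> P (t - i)" "\<not> P (t - Suc j)"
    using first_change[of "\<lambda>i. P (t - i)" 0 "t - a"] assms by (auto simp del: diff_is_0_eq)
  show thesis
  proof (rule that[of "t - Suc j" "Suc k"])
    fix i assume i: "t - Suc j < i" "i < Suc k"
    show "P i"
    proof (cases "t \<le> i")
      case False
      then have "P (t - (t - i))" using i j(2) by (intro j(3)) auto
      then show ?thesis using False by simp
    qed (use i k(3) in auto)
  qed (use j k in auto)
qed

section \<open>Moves that need all children pebbled\<close>

lemma black_placed_children: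
  assumes "bw_move_ws T C C'" "v \<notin> fst C" "v \<in> fst C'"
  shows "children T v \<subseteq> pebbled C"
  using assms unfolding bw_move_ws_def
  by (auto elim!: bw_move.cases white_slide.cases simp: pebbled_def)

lemma white_removed_children:
  assumes "bw_move T C C'" "v \<in> snd C" "v \<notin> snd C'"
  shows "children T v \<subseteq> pebbled C"
  using assms by (auto elim!: bw_move.cases simp: pebbled_def)

text \<open>A slide out of \<open>v\<close> fills the one empty child, so the children are all
  pebbled only after the move. As \<open>v\<close> is not its own child, the slide takes no pebble
  from the other children.\<close>

lemma white_removed_children_ws:
  assumes "bw_move_ws T C C'" "v \<in> snd C" "v \<notin> snd C'" "v \<notin> children T v"
  shows "children T v \<subseteq> pebbled C \<or> children T v \<subseteq> pebbled C'"
proof (cases "bw_move T C C'")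
  case True
  then show ?thesis using white_removed_children[OF True assms(2,3)] by simp
next
  case False
  then have "white_slide T C C'" using assms by (simp add: bw_move_ws_def)
  then show ?thesis
  proof cases
    case (1 i W j B)
    then have "i = v" using assms(2,3) by auto
    then have "children T v \<subseteq> pebbled C'"
      using 1 assms(4) by (auto simp: pebbled_def)
    then show ?thesis ..
  qed
qed

text \<open>Pigeonhole: at least \<open>m + 1\<close> of the times lie on one side of
  \<open>t\<close>. The one closest to \<open>t\<close> is \<open>c\<close>, and the others on that
  side form \<open>M\<close>.\<close>

lemma exists_between_many:
  fixes \<tau> :: "nat \<Rightarrow> nat"
  shows "\<exists>c<2 * m + 1. \<exists>M \<subseteq> {..<2 * m + 1} - {c}. m \<le> card M \<and>
    (\<forall>i\<in>M. \<tau> i \<le> \<tau> c \<and> \<tau> c \<le> t \<or> t \<le> \<tau> c \<and> \<tau> c \<le> \<tau> i)"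
proof -
  define J where "J = {c. c < 2 * m + 1 \<and> \<tau> c \<le> t}"
  define K where "K = {c. c < 2 * m + 1 \<and> t < \<tau> c}"
  have fin: "finite J" "finite K" by (auto simp: J_def K_def)
  have "card (J \<union> K) = card J + card K"
    using fin by (intro card_Un_disjoint) (auto simp: J_def K_def)
  moreover have "J \<union> K = {..<2 * m + 1}" by (auto simp: J_def K_def)
  ultimately have "card J + card K = 2 * m + 1" by simp
  then consider "m + 1 \<le> card J" | "m + 1 \<le> card K" by linarith
  then show ?thesis
  proof cases
    case 1
    then have "J \<noteq> {}" by auto
    then obtain c where c: "c \<in> J" "\<And>i. i \<in> J \<Longrightarrow> \<tau> i \<le> \<tau> c"
      using obtains_MAX[OF fin(1), of \<tau>]
      by (metis Max_ge finite_imageI fin(1) imageI)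
    show ?thesis
      by (rule exI[of _ c], intro conjI exI[of _ "J - {c}"])
        (use c 1 fin in \<open>auto simp: J_def\<close>)
  next
    case 2
    then have "K \<noteq> {}" by auto
    then obtain c where c: "c \<in> K" "\<And>i. i \<in> K \<Longrightarrow> \<tau> c \<le> \<tau> i"
      using obtains_MIN[OF fin(2), of \<tau>] by (metis Min_le finite_imageI fin(2) imageI)
    show ?thesis
      by (rule exI[of _ c], intro conjI exI[of _ "K - {c}"])
        (use c 2 fin in \<open>auto simp: K_def\<close>)
  qed
qed

section \<open>Forced peaks with white sliding allowed\<close>

locale ws_play =
  fixes f :: "nat \<Rightarrow> nat list bw_config" and N d H :: nat
  assumes move_ws: "k < N \<Longrightarrow> bw_move_ws (balanced_tree d H) (f k) (f (Suc k))"
    and finite_pebbled: "finite (pebbled (f k))"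
begin

definition idle :: "nat \<Rightarrow> nat list \<Rightarrow> bool" where
  "idle k v \<longleftrightarrow> pebbled (f k) \<inter> below v = {}"

text \<open>Quantifying over all intervals with idle ends makes the notion inductive: a child
  subtree may be pebbled several times during one phase of its parent, and each time must contain a
  peak.\<close>

definition forces :: "nat list \<Rightarrow> nat \<Rightarrow> bool" where
  "forces v q \<longleftrightarrow> (\<forall>a t b. a \<le> t \<and> t \<le> b \<and> b \<le> N \<and> idle a v \<and> idle b v \<and> v \<in> pebbled (f t) \<longrightarrow>
     (\<exists>k\<in>{a..b}. q \<le> load (f k) v))"

lemma forces_mono: "forces v q \<Longrightarrow> q' \<le> q \<Longrightarrow> forces v q'"
  unfolding forces_def by (meson order_trans)

lemma load_idle: "load (f k) v = 0 \<longleftrightarrow> idle k v"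
  using finite_pebbled by (simp add: load_def idle_def)

lemma idle_child: "idle k v \<Longrightarrow> idle k (v @ [c])"
  using below_child_subset by (auto simp: idle_def)

lemma idle_not_pebbled: "idle k v \<Longrightarrow> v \<notin> pebbled (f k)"
  by (auto simp: idle_def)

lemma not_own_child: "v \<notin> children (balanced_tree d H) v"
  by (auto simp: balanced_tree_def)

lemma children_subset_iff:
  assumes "Suc (length v) < H"
  shows "children (balanced_tree d H) v \<subseteq> S \<longleftrightarrow> (\<forall>c<d. v @ [c] \<in> S)"
  using assms by (auto simp: balanced_tree_def)

lemma black_critical:
  assumes "v \<notin> fst (f a)" "v \<in> fst (f t)" "a \<le> t" "t \<le> N"
  obtains k where "a \<le> k" "k < t" "children (balanced_tree d H) v \<subseteq> pebbled (f k)"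
proof -
  obtain k where "a \<le> k" "k < t" "v \<notin> fst (f k)" "v \<in> fst (f (Suc k))"
    using first_change[of "\<lambda>k. v \<notin> fst (f k)" a t] assms by (metis order_refl)
  then show thesis
    using that[of k] black_placed_children[OF move_ws[of k]] assms by auto
qed

text \<open>
  A white slide out of \<open>v\<close> completes the pebbles on the children, so the time sought may be the one just
  after the move.
\<close>

lemma children_critical:
  assumes "idle a v" "idle b v" "v \<in> pebbled (f t)" "a \<le> t" "t \<le> b" "b \<le> N"
  obtains k where "a \<le> k" "k \<le> b" "children (balanced_tree d H) v \<subseteq> pebbled (f k)"
proof (cases "v \<in> fst (f t)")
  case True
  moreover have "v \<notin> fst (f a)" using assms idle_not_pebbled by (auto simp: pebbled_def)
  ultimately show thesis using black_critical[of v a t] assms that by (metis le_trans less_imp_le)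
next
  case False
  then have "v \<in> snd (f t)" "v \<notin> snd (f b)"
    using assms idle_not_pebbled by (auto simp: pebbled_def)
  then obtain k where k: "t \<le> k" "k < b" "v \<in> snd (f k)" "v \<notin> snd (f (Suc k))"
    using first_change[of "\<lambda>k. v \<in> snd (f k)" t b] assms by (metis order_refl)
  then show thesis
    using that[of k] that[of "Suc k"] white_removed_children_ws[OF move_ws[of k]]
      not_own_child assms by force
qed

text \<open>For each child, \<open>s\<close> and \<open>e\<close> bound the maximal interval around
  \<open>t\<close> on which its subtree holds a pebble, and \<open>forces\<close> on that interval
  yields the peak time \<open>\<tau>\<close>. The peak is interior because \<open>q\<close> is
  positive and the ends are idle.\<close>

lemma children_peaks:
  assumes "idle a v" "idle b v" "a \<le> t" "t \<le> b" "b \<le> N"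
    and "\<And>c. c < d \<Longrightarrow> v @ [c] \<in> pebbled (f t)"
    and "\<And>c. c < d \<Longrightarrow> forces (v @ [c]) q" "0 < q"
  obtains s e \<tau> where
    "\<And>c. c < d \<Longrightarrow> a \<le> s c \<and> s c < t \<and> t < e c \<and> e c \<le> b \<and> s c < \<tau> c \<and> \<tau> c < e c"
    "\<And>c. c < d \<Longrightarrow> q \<le> load (f (\<tau> c)) (v @ [c])"
    "\<And>c. c < d \<Longrightarrow> idle (s c) (v @ [c]) \<and> idle (e c) (v @ [c])"
    "\<And>c i. c < d \<Longrightarrow> s c < i \<Longrightarrow> i < e c \<Longrightarrow> 0 < load (f i) (v @ [c])"
proof -
  have "\<exists>s e \<tau>. a \<le> s \<and> s < t \<and> t < e \<and> e \<le> b \<and> s < \<tau> \<and> \<tau> < e \<and> q \<le> load (f \<tau>) (v @ [c]) \<and>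
      idle s (v @ [c]) \<and> idle e (v @ [c]) \<and> (\<forall>i. s < i \<and> i < e \<longrightarrow> 0 < load (f i) (v @ [c]))"
    if c: "c < d" for c
  proof -
    have "\<not> idle t (v @ [c])" using assms(6)[OF c] idle_not_pebbled by blast
    moreover have "idle a (v @ [c])" "idle b (v @ [c])" using assms(1,2) idle_child by blast+
    ultimately obtain s e where se: "a \<le> s" "s < t" "t < e" "e \<le> b" "idle s (v @ [c])"
        "idle e (v @ [c])" "\<And>i. s < i \<Longrightarrow> i < e \<Longrightarrow> \<not> idle i (v @ [c])"
      using maximal_interval[of "\<lambda>i. \<not> idle i (v @ [c])" a b t] assms(3,4) by metis
    have "\<exists>k\<in>{s..e}. q \<le> load (f k) (v @ [c])"
      using assms(7)[OF c] se assms(5) assms(6)[OF c] unfolding forces_def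
      by (meson le_trans less_imp_le)
    then obtain \<tau> where \<tau>: "\<tau> \<in> {s..e}" "q \<le> load (f \<tau>) (v @ [c])" by blast
    then have "\<not> idle \<tau> (v @ [c])" using \<open>0 < q\<close> load_idle[of \<tau> "v @ [c]"] by auto
    then have "\<tau> \<noteq> s" "\<tau> \<noteq> e" using se by auto
    then have "s < \<tau>" "\<tau> < e" using \<tau> by auto
    moreover have "0 < load (f i) (v @ [c])" if "s < i" "i < e" for i
      using se(7)[OF that] load_idle[of i "v @ [c]"] by linarith
    ultimately show ?thesis using se \<tau> by blast
  qed
  then show thesis using that by metis
qed

text \<open>At the critical time each child contributes a pebble. At height 2 this is the base case
  of both lower bounds.\<close>

lemma forces_leaf_parent:
  assumes "Suc (length v) < H"
  shows "forces v d"
  unfolding forces_def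
proof (intro allI impI, elim conjE)
  fix a t b
  assume "a \<le> t" "t \<le> b" "b \<le> N" "idle a v" "idle b v" "v \<in> pebbled (f t)"
  then obtain k where k: "a \<le> k" "k \<le> b" "\<And>c. c < d \<Longrightarrow> v @ [c] \<in> pebbled (f k)"
    using children_critical children_subset_iff[OF assms] by metis
  have "0 < load (f k) (v @ [c])" if "c < d" for c
    using k(3)[OF that] idle_not_pebbled load_idle by (metis gr0I)
  then have "(\<Sum>c<d. 1) \<le> (\<Sum>c<d. load (f k) (v @ [c]))" by (intro sum_mono) (simp add: Suc_leI)
  also have "\<dots> \<le> load (f k) v" using sum_load_children_le finite_pebbled by blast
  finally show "\<exists>k\<in>{a..b}. d \<le> load (f k) v" using k by auto
qed

lemma forces_odd_step:
  assumes "Suc (length v) < H" "d = 2 * m + 1" "0 < q"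
    and "\<And>c. c < d \<Longrightarrow> forces (v @ [c]) q"
  shows "forces v (q + m)"
  unfolding forces_def
proof (intro allI impI, elim conjE)
  fix a t b
  assume A: "a \<le> t" "t \<le> b" "b \<le> N" "idle a v" "idle b v" "v \<in> pebbled (f t)"
  then obtain k where k: "a \<le> k" "k \<le> b" "\<And>c. c < d \<Longrightarrow> v @ [c] \<in> pebbled (f k)"
    using children_critical children_subset_iff[OF assms(1)] by metis
  obtain s e \<tau> where
    se: "\<And>c. c < d \<Longrightarrow> a \<le> s c \<and> s c < k \<and> k < e c \<and> e c \<le> b \<and> s c < \<tau> c \<and> \<tau> c < e c"
    and peak: "\<And>c. c < d \<Longrightarrow> q \<le> load (f (\<tau> c)) (v @ [c])"
    and busy: "\<And>c i. c < d \<Longrightarrow> s c < i \<Longrightarrow> i < e c \<Longrightarrow> 0 < load (f i) (v @ [c])"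
    using children_peaks[OF A(4,5) k(1,2) A(3) k(3) assms(4,3)] by metis
  obtain c M where c: "c < d" and M: "M \<subseteq> {..<d} - {c}" "m \<le> card M"
    and between: "\<And>i. i \<in> M \<Longrightarrow> \<tau> i \<le> \<tau> c \<and> \<tau> c \<le> k \<or> k \<le> \<tau> c \<and> \<tau> c \<le> \<tau> i"
    using exists_between_many[of m \<tau> k] unfolding assms(2) by metis
  have finM: "finite M" using M(1) by (rule finite_subset) simp
  have "q + m \<le> load (f (\<tau> c)) (v @ [c]) + (\<Sum>i\<in>M. 1)" using peak[OF c] M by simp
  also have "\<dots> \<le> load (f (\<tau> c)) (v @ [c]) + (\<Sum>i\<in>M. load (f (\<tau> c)) (v @ [i]))"
  proof (intro add_left_mono sum_mono)
    fix i assume i: "i \<in> M"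
    then have "i < d" using M by auto
    \<comment> \<open>The time \<open>\<tau> c\<close> lies between \<open>k\<close> and
      \<open>\<tau> i\<close>, which are both inside the busy interval of child
      \<open>i\<close>.\<close>
    then have "0 < load (f (\<tau> c)) (v @ [i])"
      using busy[of i "\<tau> c"] se[of i] between[OF i] by linarith
    then show "1 \<le> load (f (\<tau> c)) (v @ [i])" by simp
  qed
  also have "\<dots> = (\<Sum>i\<in>insert c M. load (f (\<tau> c)) (v @ [i]))"
    using M finM by (subst sum.insert) auto
  also have "\<dots> \<le> load (f (\<tau> c)) v"
    using sum_load_children_le finite_pebbled finM by blast
  finally show "\<exists>k\<in>{a..b}. q + m \<le> load (f k) v"
    using se[OF c] by (intro bexI[of _ "\<tau> c"]) auto
qed

lemma forces_odd:
  assumes "d = 2 * m + 1" "2 \<le> h" "length v + h = H"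
  shows "forces v (m * h + 1)"
  using assms(2,3)
proof (induction h arbitrary: v rule: nat_induct_at_least)
  case base
  then show ?case using forces_leaf_parent[of v] assms(1) by (simp add: mult.commute)
next
  case (Suc h)
  have "forces v ((m * h + 1) + m)"
    using Suc by (intro forces_odd_step[OF _ assms(1)]) auto
  then show ?case by (simp add: algebra_simps)
qed

end

section \<open>Forced peaks in the binary tree without white sliding\<close>

locale play = ws_play +
  assumes move: "k < N \<Longrightarrow> bw_move (balanced_tree d H) (f k) (f (Suc k))"
    and binary: "d = 2"
begin

lemma load_children_le:
  assumes "{c, c'} = {0, 1}"
  shows "load (f k) (v @ [c]) + load (f k) (v @ [c']) \<le> load (f k) v"
proof -
  have "c \<noteq> c'" using assms by (auto simp: doubleton_eq_iff)
  then show ?thesis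
    using sum_load_children_le[OF finite_pebbled[of k], where J = "{c, c'}" and v = v] by simp
qed

text \<open>Without slides a white pebble leaves \<open>v\<close> only while all children are
  pebbled, so it is still on \<open>v\<close> at the critical time. If \<open>v\<close> is black at
  \<open>t\<close>, the critical time precedes \<open>t\<close> and the last clause is
  vacuous.\<close>

lemma children_critical_coloured:
  assumes "idle a v" "idle b v" "v \<in> pebbled (f t)" "a \<le> t" "t \<le> b" "b \<le> N"
  obtains k where "a \<le> k" "k \<le> b" "children (balanced_tree d H) v \<subseteq> pebbled (f k)"
    "\<And>i. t \<le> i \<Longrightarrow> i \<le> k \<Longrightarrow> v \<in> pebbled (f i)"
proof (cases "v \<in> fst (f t)")
  case True
  have "v \<notin> fst (f a)" using assms idle_not_pebbled by (auto simp: pebbled_def)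
  moreover have "t \<le> N" using assms(5,6) by linarith
  ultimately obtain k where "a \<le> k" "k < t" "children (balanced_tree d H) v \<subseteq> pebbled (f k)"
    using black_critical[OF _ True assms(4)] by blast
  then show thesis using that[of k] assms by auto
next
  case False
  then have "v \<in> snd (f t)" "v \<notin> snd (f b)"
    using assms idle_not_pebbled by (auto simp: pebbled_def)
  then obtain k where k: "t \<le> k" "k < b" "\<And>i. t \<le> i \<Longrightarrow> i \<le> k \<Longrightarrow> v \<in> snd (f i)"
      "v \<notin> snd (f (Suc k))"
    using first_change[of "\<lambda>k. v \<in> snd (f k)" t b] assms by blast
  then have "children (balanced_tree d H) v \<subseteq> pebbled (f k)"
    using white_removed_children[OF move[of k]] assms by auto
  then show thesis using that[of k] k assms by (auto simp: pebbled_def)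
qed

text \<open>
  If the node is black at time \<open>t\<close>, its children were all pebbled before \<open>t\<close>, so both child peaks come
  later, and the other child subtree is busy at the first of them. If it is white at time \<open>t\<close>, it
  stays white until its children are all pebbled, and a peak in between is counted on top of it.
  The case \<open>q = 2\<close> covers nodes whose children are leaves.
\<close>

lemma late_peak:
  assumes "Suc (length v) < H" "0 < q"
    and "q = 2 \<or> (\<forall>c<2. forces (v @ [c]) q)"
    and "idle a v" "idle b v" "v \<in> pebbled (f t)" "a \<le> t" "t \<le> b" "b \<le> N"
    and early: "\<And>k. a \<le> k \<Longrightarrow> k \<le> t \<Longrightarrow> load (f k) v < q"
  shows "\<exists>k\<in>{a..b}. q < load (f k) v"
proof -
  obtain k where k: "a \<le> k" "k \<le> b" "\<And>c. c < d \<Longrightarrow> v @ [c] \<in> pebbled (f k)"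
    "\<And>i. t \<le> i \<Longrightarrow> i \<le> k \<Longrightarrow> v \<in> pebbled (f i)"
    using children_critical_coloured[OF assms(4-9)] children_subset_iff[OF assms(1)] by metis
  show ?thesis
  proof (cases "\<forall>c<2. forces (v @ [c]) q")
    case True
    obtain s e \<tau> where
      se: "\<And>c. c < d \<Longrightarrow> a \<le> s c \<and> s c < k \<and> k < e c \<and> e c \<le> b \<and> s c < \<tau> c \<and> \<tau> c < e c"
      and peak: "\<And>c. c < d \<Longrightarrow> q \<le> load (f (\<tau> c)) (v @ [c])"
      and busy: "\<And>c i. c < d \<Longrightarrow> s c < i \<Longrightarrow> i < e c \<Longrightarrow> 0 < load (f i) (v @ [c])"
      using children_peaks[OF assms(4,5) k(1,2) assms(9) k(3) _ assms(2)] True binary by metis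
    show ?thesis
    proof (cases "\<exists>c<d. \<tau> c \<le> k")
      case True
      then obtain c where c: "c < d" "\<tau> c \<le> k" by blast
      have le: "q \<le> load (f (\<tau> c)) v"
        using peak[OF c(1)] sum_load_children_le[OF finite_pebbled[of "\<tau> c"], where J = "{c}" and v = v] by force
      \<comment> \<open>A peak by time \<open>t\<close> would contradict \<open>early\<close>;
        between \<open>t\<close> and \<open>k\<close> the node \<open>v\<close> itself is pebbled
        and adds one.\<close>
      then have "t < \<tau> c" using early[of "\<tau> c"] se[OF c(1)] by force
      then have "Suc (load (f (\<tau> c)) (v @ [c])) \<le> load (f (\<tau> c)) v"
        using load_child_Suc_le[OF finite_pebbled[of "\<tau> c"], where J = "{c}" and v = v] k(4) c by force
      then show ?thesis
        using peak[OF c(1)] se[OF c(1)] by (intro bexI[of _ "\<tau> c"]) auto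
    next
      case False
      obtain c c' where c: "{c, c'} = {0, 1::nat}" "\<tau> c \<le> \<tau> c'"
        by (metis insert_commute nat_le_linear)
      then have "c < d" "c' < d" using binary by (auto simp: doubleton_eq_iff)
      moreover from this have "0 < load (f (\<tau> c)) (v @ [c'])"
        using False busy[of c' "\<tau> c"] se[of c'] se[of c] c(2) by force
      ultimately have "q < load (f (\<tau> c)) v"
        using load_children_le[OF c(1), of "\<tau> c" v] peak[of c] by linarith
      then show ?thesis using se[OF \<open>c < d\<close>] by (intro bexI[of _ "\<tau> c"]) auto
    qed
  next
    case False
    \<comment> \<open>The two pebbled children already give load 2 at \<open>k\<close>, so
      \<open>early\<close> puts \<open>k\<close> after \<open>t\<close>; then \<open>v\<close> is
      still pebbled and is counted third.\<close>
    then have q: "q = 2" using assms(3) by blast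
    have pos: "0 < load (f k) (v @ [c])" if "c < 2" for c
      using k(3) that binary idle_not_pebbled load_idle by (metis gr0I)
    have "(\<Sum>c\<in>{0, 1}. load (f k) (v @ [c])) \<ge> 2" using pos[of 0] pos[of 1] by simp
    then have "2 \<le> load (f k) v" "v \<in> pebbled (f k) \<Longrightarrow> 3 \<le> load (f k) v"
      using sum_load_children_le[OF finite_pebbled[of k], where J = "{0, 1}" and v = v]
        load_child_Suc_le[OF finite_pebbled[of k], where J = "{0, 1}" and v = v] by simp_all
    moreover from this have "t < k" using early[of k] k(1) q by force
    ultimately show ?thesis using k(1,2,4) q by (intro bexI[of _ k]) auto
  qed
qed

text \<open>If \<open>q\<close> pebbles sufficed, neither child could peak during the phase of the
  other, so one peak would precede the whole phase of the other child. That other child then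
  satisfies the hypotheses of \<open>late_peak\<close> and exceeds \<open>q\<close>.\<close>

lemma forces_two_levels:
  assumes "length v + 2 < H" "0 < q"
    and "\<And>c. c < 2 \<Longrightarrow> forces (v @ [c]) q"
    and "q = 2 \<or> (\<forall>c<2. \<forall>c'<2. forces (v @ [c, c']) q)"
  shows "forces v (q + 1)"
  unfolding forces_def
proof (intro allI impI, elim conjE)
  fix a t b
  assume A: "a \<le> t" "t \<le> b" "b \<le> N" "idle a v" "idle b v" "v \<in> pebbled (f t)"
  then obtain k where k: "a \<le> k" "k \<le> b" "\<And>c. c < d \<Longrightarrow> v @ [c] \<in> pebbled (f k)"
    using children_critical children_subset_iff[of v] assms(1)
    by (metis One_nat_def Suc_eq_plus1 Suc_lessD add_2_eq_Suc')
  obtain s e \<tau> where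
    se: "\<And>c. c < d \<Longrightarrow> a \<le> s c \<and> s c < k \<and> k < e c \<and> e c \<le> b \<and> s c < \<tau> c \<and> \<tau> c < e c"
    and peak: "\<And>c. c < d \<Longrightarrow> q \<le> load (f (\<tau> c)) (v @ [c])"
    and ends: "\<And>c. c < d \<Longrightarrow> idle (s c) (v @ [c]) \<and> idle (e c) (v @ [c])"
    and busy: "\<And>c i. c < d \<Longrightarrow> s c < i \<Longrightarrow> i < e c \<Longrightarrow> 0 < load (f i) (v @ [c])"
    using children_peaks[OF A(4,5) k(1,2) A(3) k(3) _ assms(2)] assms(3) binary by metis
  show "\<exists>k\<in>{a..b}. q + 1 \<le> load (f k) v"
  proof (rule ccontr)
    assume "\<not> ?thesis"
    then have small: "load (f i) v \<le> q" if "a \<le> i" "i \<le> b" for i using that by force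
    \<comment> \<open>At the peak of \<open>c\<close> the full allowance \<open>q\<close> sits below
      \<open>c\<close>, so this time is outside the phase of \<open>c'\<close>.\<close>
    have alone: "\<tau> c \<le> s c' \<or> e c' \<le> \<tau> c" if "{c, c'} = {0, 1}" for c c'
    proof (rule ccontr)
      assume "\<not> ?thesis"
      moreover have "c < d" "c' < d" using that binary by (auto simp: doubleton_eq_iff)
      ultimately show False
        using busy[of c' "\<tau> c"] peak[of c] load_children_le[OF that, of "\<tau> c" v]
          small[of "\<tau> c"] se[of c] by linarith
    qed
    obtain c c' where cc: "{c, c'} = {0, 1::nat}" "\<tau> c' \<le> \<tau> c"
      by (metis insert_commute nat_le_linear)
    have cd: "c < d" "c' < d" using cc(1) binary by (auto simp: doubleton_eq_iff)
    \<comment> \<open>The other alternative would give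
      \<open>e c \<le> \<tau> c' \<le> \<tau> c < e c\<close>.\<close>
    have "\<tau> c' \<le> s c"
      using alone[OF cc(1)] alone[of c' c] cc se[OF cd(1)] se[OF cd(2)] by (force simp: insert_commute)
    \<comment> \<open>Here \<open>late_peak\<close> is applied to child \<open>c\<close> on its
      phase, with \<open>k\<close> as the time \<open>t\<close>. From \<open>s c\<close> to
      \<open>k\<close> the subtree of \<open>c'\<close> is busy, which leaves fewer than
      \<open>q\<close> pebbles for \<open>c\<close>.\<close>
    have "\<exists>i\<in>{s c..e c}. q < load (f i) (v @ [c])"
    proof (rule late_peak)
      show "q = 2 \<or> (\<forall>i<2. forces ((v @ [c]) @ [i]) q)" using assms(4) cd binary by auto
      fix i assume i: "s c \<le> i" "i \<le> k"
      then have "0 < load (f i) (v @ [c'])"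
        using busy[of c' i] se[OF cd(2)] cd \<open>\<tau> c' \<le> s c\<close> by force
      then show "load (f i) (v @ [c]) < q"
        using load_children_le[OF cc(1), of i v] small[of i] i k se[OF cd(1)] by force
    qed (use assms k ends cd se[OF cd(1)] A in auto)
    then obtain i where "s c \<le> i" "i \<le> e c" "q < load (f i) (v @ [c])" by auto
    then show False
      using load_children_le[OF cc(1), of i v] small[of i] se[OF cd(1)] by force
  qed
qed

text \<open>The bound is one plus the ceiling of \<open>h / 2\<close> and grows with every second
  level: the grandchildren supply \<open>q\<close>, and the children, one level higher, at least
  \<open>q\<close>.\<close>

lemma forces_binary:
  assumes "2 \<le> h" "length v + h = H"
  shows "forces v (Suc h div 2 + 1)"
  using assms
proof (induction h arbitrary: v rule: less_induct)
  case (less h)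
  consider "h = 2" | "h = 3" | "4 \<le> h" using less.prems by linarith
  then show ?case
  proof cases
    case 1
    then have "forces v 2" "Suc h div 2 + 1 = 2"
      using forces_leaf_parent[of v] less.prems binary by simp_all
    then show ?thesis by metis
  next
    case 2
    \<comment> \<open>The grandchildren are leaves here, so the alternative \<open>q = 2\<close> of
      \<open>forces_two_levels\<close> is used.\<close>
    have eq: "Suc 2 div 2 + 1 = (2::nat)" "Suc h div 2 + 1 = 2 + 1" using 2 by simp_all
    have "forces (v @ [c]) (Suc 2 div 2 + 1)" for c
      by (rule less.IH) (use less.prems 2 in auto)
    then have "forces (v @ [c]) 2" for c unfolding eq .
    then have "forces v (2 + 1)"
      by (rule forces_two_levels[rotated 2]) (use less.prems 2 in auto)
    then show ?thesis unfolding eq .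
  next
    case 3
    define q where "q = Suc (h - 2) div 2 + 1"
    have "forces (v @ [c]) (Suc (h - 1) div 2 + 1)" for c
      using less.IH[of "h - 1" "v @ [c]"] less.prems 3 by simp
    then have 1: "forces (v @ [c]) q" for c by (rule forces_mono) (auto simp: q_def intro: div_le_mono)
    have 2: "forces (v @ [c, c']) q" for c c'
      using less.IH[of "h - 2" "v @ [c, c']"] less.prems 3 by (simp add: q_def)
    have "forces v (q + 1)" by (rule forces_two_levels) (use 1 2 less.prems 3 q_def in auto)
    moreover have "q + 1 = Suc h div 2 + 1" using 3 by (simp add: q_def)
    ultimately show ?thesis by simp
  qed
qed

end

section \<open>Upper bounds\<close>

definition config_within :: "'v set \<Rightarrow> nat \<Rightarrow> 'v bw_config \<Rightarrow> bool" where
  "config_within S q C \<longleftrightarrow> finite (pebbled C) \<and> pebbled C \<subseteq> S \<and> fst C \<inter> snd C = {} \<and> num_pebbles C \<le> q"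

text \<open>Only nodes of \<open>S\<close> are altered, while \<open>B\<close> and \<open>W\<close>
  may extend beyond \<open>S\<close>; so pebbles parked elsewhere can accompany a play
  unchanged.\<close>

inductive move_in :: "('v, 'm) rooted_tree_scheme \<Rightarrow> 'v set \<Rightarrow> 'v bw_config \<Rightarrow> 'v bw_config \<Rightarrow> bool"
  for T :: "('v, 'm) rooted_tree_scheme" and S where
  remove_black: "i \<in> B \<Longrightarrow> i \<in> S \<Longrightarrow> move_in T S (B, W) (B - {i}, W)"
| place_white: "i \<in> S \<Longrightarrow> i \<notin> B \<union> W \<Longrightarrow> move_in T S (B, W) (B, insert i W)"
| remove_white: "i \<in> S \<Longrightarrow> children T i \<subseteq> B \<union> W \<Longrightarrow> R \<subseteq> children T i \<inter> S
    \<Longrightarrow> move_in T S (B, W) (B - R, W - {i})"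
| place_black: "i \<in> S \<Longrightarrow> children T i \<subseteq> B \<union> W \<Longrightarrow> R \<subseteq> children T i \<inter> S
    \<Longrightarrow> move_in T S (B, W) (insert i (B - R), W - {i})"

definition reach ::
  "('v, 'm) rooted_tree_scheme \<Rightarrow> 'v set \<Rightarrow> nat \<Rightarrow> 'v bw_config \<Rightarrow> 'v bw_config \<Rightarrow> bool" where
  "reach T S q C C' \<longleftrightarrow> config_within S q C \<and>
     (\<lambda>C C'. move_in T S C C' \<and> config_within S q C')\<^sup>*\<^sup>* C C'"

lemma move_in_bw_move: "move_in T S C C' \<Longrightarrow> S \<subseteq> nodes T \<Longrightarrow> bw_move T C C'"
  by (auto elim!: move_in.cases intro: bw_move.intros)

lemma move_in_frame:
  assumes "move_in T S C C'" "S \<subseteq> S'" "S \<inter> (B0 \<union> W0) = {}"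
  shows "move_in T S' (fst C \<union> B0, snd C \<union> W0) (fst C' \<union> B0, snd C' \<union> W0)"
  using assms(1)
proof cases
  case (remove_black i B W)
  then have "(B - {i}) \<union> B0 = (B \<union> B0) - {i}" using assms(3) by auto
  then show ?thesis using remove_black assms(2) by (auto intro!: move_in.remove_black)
next
  case (place_white i B W)
  then show ?thesis using assms(2,3) by (auto intro!: move_in.place_white)
next
  case (remove_white i B W R)
  then have "(B - R) \<union> B0 = (B \<union> B0) - R" "(W - {i}) \<union> W0 = (W \<union> W0) - {i}" using assms(3) by auto
  then show ?thesis using remove_white assms(2) by (auto intro!: move_in.remove_white)
next
  case (place_black i B W R)
  then have "insert i (B - R) \<union> B0 = insert i ((B \<union> B0) - R)"
    "(W - {i}) \<union> W0 = (W \<union> W0) - {i}" using assms(3) by auto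
  then show ?thesis using place_black assms(2) by (auto intro!: move_in.place_black)
qed

lemma config_within_frame:
  assumes "config_within S q C" "config_within S0 r (B0, W0)" "S \<inter> S0 = {}" "S \<union> S0 \<subseteq> S'" "q + r \<le> p"
  shows "config_within S' p (fst C \<union> B0, snd C \<union> W0)"
proof -
  have "card (fst C \<union> B0) \<le> card (fst C) + card B0" "card (snd C \<union> W0) \<le> card (snd C) + card W0"
    by (rule card_Un_le)+
  then show ?thesis
    using assms unfolding config_within_def pebbled_def num_pebbles_def by auto
qed

lemma reach_refl: "config_within S q C \<Longrightarrow> reach T S q C C"
  by (simp add: reach_def)

lemma reach_trans: "reach T S q C C' \<Longrightarrow> reach T S q C' C'' \<Longrightarrow> reach T S q C C''"
  unfolding reach_def by auto

lemma reach_step: "move_in T S C C' \<Longrightarrow> config_within S q C \<Longrightarrow> config_within S q C' \<Longrightarrow> reach T S q C C'"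
  unfolding reach_def by auto

lemma reach_config_within:
  assumes "reach T S q C C'" shows "config_within S q C" "config_within S q C'"
proof -
  have "(\<lambda>C C'. move_in T S C C' \<and> config_within S q C')\<^sup>*\<^sup>* C C'" "config_within S q C"
    using assms by (auto simp: reach_def)
  then show "config_within S q C" "config_within S q C'" by (induction rule: rtranclp_induct) auto
qed

text \<open>A frame rule in the sense of separation logic: a play on \<open>S\<close> runs beside
  pebbles parked on \<open>S0\<close>, and the budgets add up. This is how one child subtree is
  played while its siblings hold pebbles.\<close>

lemma reach_frame:
  assumes "reach T S q (B, W) (B', W')" "config_within S0 r (B0, W0)" "S \<inter> S0 = {}" "S \<union> S0 \<subseteq> S'"
    "q + r \<le> p"
  shows "reach T S' p (B \<union> B0, W \<union> W0) (B' \<union> B0, W' \<union> W0)"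
proof -
  let ?F = "\<lambda>C. (fst C \<union> B0, snd C \<union> W0)"
  have disj: "S \<inter> (B0 \<union> W0) = {}" using assms(2,3) by (auto simp: config_within_def pebbled_def)
  have "reach T S' p (?F (B, W)) (?F C)"
    if "(\<lambda>C C'. move_in T S C C' \<and> config_within S q C')\<^sup>*\<^sup>* (B, W) C" for C
    using that
  proof (induction rule: rtranclp_induct)
    case base
    then show ?case
      using assms(1) config_within_frame[OF _ assms(2-5), of "(B, W)"]
      by (intro reach_refl) (auto simp: reach_def)
  next
    case (step C C')
    have "move_in T S' (?F C) (?F C')" using step move_in_frame disj assms(4) by (metis Un_subset_iff)
    then have "reach T S' p (?F C) (?F C')"
      using step config_within_frame[OF _ assms(2-5)] reach_config_within(2) by (intro reach_step) blast+
    then show ?case using step.IH reach_trans by blast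
  qed
  then show ?thesis using assms(1) by (fastforce simp: reach_def)
qed

lemma reach_mono:
  assumes "reach T S q C C'" "S \<subseteq> S'" "q \<le> q'"
  shows "reach T S' q' C C'"
  using reach_frame[of T S q "fst C" "snd C" "fst C'" "snd C'" "{}" 0 "{}" "{}" S' q'] assms
  by (simp add: config_within_def pebbled_def num_pebbles_def)

lemma reach_pebbling:
  assumes "reach T S p ({}, {}) C1" "reach T S p C1 ({}, {})" "root T \<in> fst C1" "S \<subseteq> nodes T"
  shows "\<exists>cs. bw_pebbling T (bw_move T) p cs"
proof -
  have path: "\<exists>cs. cs \<noteq> [] \<and> hd cs = C \<and> last cs = C' \<and> successively (bw_move T) cs \<and>
      (\<forall>D\<in>set cs. config_within S p D)" if "reach T S p C C'" for C C'
  proof -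
    have "(\<lambda>C C'. move_in T S C C' \<and> config_within S p C')\<^sup>*\<^sup>* C C'" "config_within S p C"
      using that by (auto simp: reach_def)
    then show ?thesis
    proof (induction rule: rtranclp_induct)
      case base
      then show ?case by (intro exI[of _ "[C]"]) simp
    next
      case (step C' C'')
      then obtain cs where "cs \<noteq> []" "hd cs = C" "last cs = C'" "successively (bw_move T) cs"
        "\<forall>D\<in>set cs. config_within S p D" by blast
      then show ?case
        using step.hyps move_in_bw_move[OF _ assms(4)]
        by (intro exI[of _ "cs @ [C'']"]) (auto simp: successively_append_iff)
    qed
  qed
  obtain us where us: "us \<noteq> []" "hd us = ({}, {})" "last us = C1" "successively (bw_move T) us"
    "\<forall>D\<in>set us. config_within S p D" using path[OF assms(1)] by blast
  obtain ds where ds: "ds \<noteq> []" "hd ds = C1" "last ds = ({}, {})" "successively (bw_move T) ds"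
    "\<forall>D\<in>set ds. config_within S p D" using path[OF assms(2)] by blast
  \<comment> \<open>The junction \<open>C1\<close> is kept once, since a second copy would require a
    move from \<open>C1\<close> to itself.\<close>
  then obtain es where es: "ds = C1 # es" by (cases ds) auto
  have "successively (bw_move T) (us @ es)"
    using us ds(4) unfolding es by (auto simp: successively_append_iff successively_Cons)
  moreover have "last (us @ es) = ({}, {})"
    using us(3) ds(3) unfolding es by (auto simp: last_append split: if_splits)
  moreover have "C1 \<in> set us" using us by (metis last_in_set)
  moreover have "is_bw_config T D \<and> num_pebbles D \<le> p" if "D \<in> set (us @ es)" for D
  proof -
    have "config_within S p D" using that us(5) ds(5) unfolding es by auto
    then show ?thesis using assms(4) by (auto simp: config_within_def is_bw_config_def pebbled_def)
  qed
  ultimately have "bw_pebbling T (bw_move T) p (us @ es)"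
    using us assms(3) unfolding bw_pebbling_def by auto
  then show ?thesis by blast
qed

section \<open>Strategies around the critical time\<close>

locale tree =
  fixes d H :: nat
begin

abbreviation T :: "nat list rooted_tree" where
  "T \<equiv> balanced_tree d H"

definition sub :: "nat list \<Rightarrow> nat list set" where
  "sub v = below v \<inter> nodes T"

text \<open>
  In \<open>critical v p q r\<close> the moves take place strictly below \<open>v\<close>, with at most \<open>p\<close> pebbles until all
  children of \<open>v\<close> are pebbled and at most \<open>q\<close> afterwards; \<open>r\<close> bounds what remains once the black
  children in \<open>R\<close> have slid to \<open>v\<close>. Leaving \<open>v\<close> itself out lets the same play either produce a black
  pebble on \<open>v\<close> (cost \<open>max p (q + 1)\<close>) or remove a white one (cost \<open>max (p + 1) q\<close>).
\<close>

definition critical :: "nat list \<Rightarrow> nat \<Rightarrow> nat \<Rightarrow> nat \<Rightarrow> bool" where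
  "critical v p q r \<longleftrightarrow> (\<exists>B W R. reach T (sub v - {v}) p ({}, {}) (B, W) \<and>
     children T v \<subseteq> B \<union> W \<and> R \<subseteq> children T v \<and> num_pebbles (B - R, W) \<le> r \<and>
     reach T (sub v - {v}) q (B - R, W) ({}, {}))"

lemma sub_nodes: "sub v \<subseteq> nodes T"
  by (simp add: sub_def)

lemma self_in_sub: "v \<in> nodes T \<Longrightarrow> v \<in> sub v"
  by (simp add: sub_def)

lemma children_sub: "v \<in> nodes T \<Longrightarrow> children T v \<subseteq> sub v - {v}"
  by (auto simp: sub_def below_def balanced_tree_def)

lemma sub_child_subset: "sub (v @ [c]) \<subseteq> sub v - {v}"
  using below_child_subset by (auto simp: sub_def)

lemma critical_mono:
  assumes "critical v p q r" "p \<le> p'" "q \<le> q'" "r \<le> r'"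
  shows "critical v p' q' r'"
  using assms reach_mono unfolding critical_def by (meson le_trans order_refl)

lemma config_within_black: "i \<in> S \<Longrightarrow> config_within S 1 ({i}, {})"
  by (simp add: config_within_def pebbled_def num_pebbles_def)

lemma config_within_white: "i \<in> S \<Longrightarrow> config_within S 1 ({}, {i})"
  by (simp add: config_within_def pebbled_def num_pebbles_def)

text \<open>The strict \<open>r < p'\<close> pays for the black pebble that \<open>v\<close>
  receives in the same move in which \<open>R\<close> is vacated.\<close>

lemma reach_black_root:
  assumes v: "v \<in> nodes T" and B: "reach T (sub v - {v}) p ({}, {}) (B, W)"
    and R: "children T v \<subseteq> B \<union> W" "R \<subseteq> children T v"
    and n: "config_within (sub v - {v}) r (B - R, W)" "r < p'" "p \<le> p'"
  shows "reach T (sub v) p' ({}, {}) (insert v (B - R), W)"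
proof -
  have up: "reach T (sub v) p' ({}, {}) (B, W)" using reach_mono[OF B] n(3) by blast
  have "v \<notin> W" using n(1) by (auto simp: config_within_def pebbled_def)
  have "config_within (sub v) p' ((B - R) \<union> {v}, W \<union> {})"
    using config_within_frame[OF n(1) config_within_black[of v "{v}"], of "sub v" p'] self_in_sub[OF v] n by auto
  then have "reach T (sub v) p' (B, W) (insert v (B - R), W - {v})"
    using R children_sub[OF v] self_in_sub[OF v] reach_config_within(2)[OF up] \<open>v \<notin> W\<close>
    by (intro reach_step move_in.place_black) auto
  then show ?thesis using reach_trans[OF up] \<open>v \<notin> W\<close> by simp
qed

text \<open>After the slide the black pebble on \<open>v\<close> frames the rest of the play, hence
  \<open>Suc q\<close>.\<close>

lemma critical_keep_black:
  assumes "critical v p q r" "v \<in> nodes T" "p \<le> p'" "Suc q \<le> p'"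
  shows "reach T (sub v) p' ({}, {}) ({v}, {})"
proof -
  obtain B W R where B: "reach T (sub v - {v}) p ({}, {}) (B, W)" "children T v \<subseteq> B \<union> W"
    "R \<subseteq> children T v" "reach T (sub v - {v}) q (B - R, W) ({}, {})"
    using assms(1) by (auto simp: critical_def)
  have "reach T (sub v) p' ({}, {}) (insert v (B - R), W)"
    using reach_black_root[OF assms(2) B(1-3) reach_config_within(1)[OF B(4)]] assms by simp
  moreover have "reach T (sub v) p' ((B - R) \<union> {v}, W \<union> {}) ({} \<union> {v}, {} \<union> {})"
    using self_in_sub[OF assms(2)] assms(4)
    by (intro reach_frame[OF B(4) config_within_black[of v "{v}"]]) auto
  ultimately show ?thesis using reach_trans by fastforce
qed

text \<open>The white pebble frames the first half and goes at the critical time, hence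
  \<open>Suc p\<close> but plain \<open>q\<close>.\<close>

lemma critical_remove_white:
  assumes "critical v p q r" "v \<in> nodes T" "Suc p \<le> p'" "q \<le> p'"
  shows "reach T (sub v) p' ({}, {v}) ({}, {})"
proof -
  obtain B W R where B: "reach T (sub v - {v}) p ({}, {}) (B, W)" "children T v \<subseteq> B \<union> W"
    "R \<subseteq> children T v" "reach T (sub v - {v}) q (B - R, W) ({}, {})"
    using assms(1) by (auto simp: critical_def)
  have up: "reach T (sub v) p' ({} \<union> {}, {} \<union> {v}) (B \<union> {}, W \<union> {v})"
    using self_in_sub[OF assms(2)] assms(3)
    by (intro reach_frame[OF B(1) config_within_white[of v "{v}"]]) auto
  have down: "reach T (sub v) p' (B - R, W) ({}, {})"
    using reach_mono[OF B(4)] assms by blast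
  have "v \<notin> W" using reach_config_within(1)[OF B(4)] by (auto simp: config_within_def pebbled_def)
  have "reach T (sub v) p' (B, insert v W) (B - R, insert v W - {v})"
    using B(2,3) children_sub[OF assms(2)] self_in_sub[OF assms(2)] \<open>v \<notin> W\<close>
      reach_config_within(2)[OF up] reach_config_within(1)[OF down]
    by (intro reach_step move_in.remove_white) auto
  then show ?thesis using up down \<open>v \<notin> W\<close> reach_trans by (metis Diff_insert_absorb Un_empty_left Un_empty_right Un_insert_right)
qed

lemma critical_leaf:
  assumes "length v + 1 = H"
  shows "critical v 0 0 0"
  unfolding critical_def using assms
  by (intro exI[of _ "{}"]) (auto simp: balanced_tree_def num_pebbles_def config_within_def pebbled_def
    intro!: reach_refl)

section \<open>Playing the children of one node\<close>

definition kids :: "nat list \<Rightarrow> nat set \<Rightarrow> nat list set" where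
  "kids v J = (\<lambda>c. v @ [c]) ` J"

lemma kids_insert: "kids v (insert c J) = insert (v @ [c]) (kids v J)"
  by (simp add: kids_def)

lemma card_kids: "card (kids v J) = card J"
  unfolding kids_def by (rule card_image) (auto simp: inj_on_def)

lemma finite_kids: "finite J \<Longrightarrow> finite (kids v J)"
  by (simp add: kids_def)

lemma child_node: "v @ [c] \<in> nodes T \<longleftrightarrow> v \<in> nodes T \<and> c < d \<and> Suc (length v) < H"
  by (auto simp: balanced_tree_def)

lemma kids_sub: "v \<in> nodes T \<Longrightarrow> Suc (length v) < H \<Longrightarrow> J \<subseteq> {..<d} \<Longrightarrow> kids v J \<subseteq> sub v - {v}"
  using child_node by (force simp: kids_def sub_def below_def)

lemma kids_disjoint: "c \<notin> J \<Longrightarrow> sub (v @ [c]) \<inter> kids v J = {}"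
  by (auto simp: kids_def sub_def below_def)

lemma config_within_black_kids: "finite J \<Longrightarrow> card J \<le> r \<Longrightarrow> config_within (kids v J) r (kids v J, {})"
  by (simp add: config_within_def pebbled_def num_pebbles_def card_kids finite_kids)

lemma config_within_white_kids: "finite J \<Longrightarrow> card J \<le> r \<Longrightarrow> config_within (kids v J) r ({}, kids v J)"
  by (simp add: config_within_def pebbled_def num_pebbles_def card_kids finite_kids)

lemma kids_frame_sub:
  assumes "v \<in> nodes T" "Suc (length v) < H" "J \<subseteq> {..<d}"
  shows "sub (v @ [c]) \<union> kids v J \<subseteq> sub v - {v}"
  using kids_sub[OF assms] sub_child_subset by blast

text \<open>The children turn black one after another. The last is played beside
  \<open>card J - 1\<close> black siblings, at cost \<open>p\<close> and then \<open>q + 1\<close>,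
  which explains the off-by-ones in \<open>bound\<close>.\<close>

lemma reach_black_kids:
  assumes v: "v \<in> nodes T" "Suc (length v) < H" and J: "finite J" "J \<subseteq> {..<d}"
    and crit: "\<And>c. c < d \<Longrightarrow> critical (v @ [c]) p q r"
    and bound: "J \<noteq> {} \<Longrightarrow> card J + p \<le> Suc p'" "J \<noteq> {} \<Longrightarrow> card J + q \<le> p'"
  shows "reach T (sub v - {v}) p' ({}, {}) (kids v J, {})"
  using J bound
proof (induction J rule: finite_induct)
  case empty
  show ?case by (simp add: kids_def reach_refl config_within_def pebbled_def num_pebbles_def)
next
  case (insert c J)
  let ?s = "p' - card J"
  have c: "c < d" "v @ [c] \<in> nodes T" using insert.prems v child_node by auto
  have "reach T (sub (v @ [c])) ?s ({}, {}) ({v @ [c]}, {})"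
    using critical_keep_black[OF crit[OF c(1)] c(2)] insert by force
  then have "reach T (sub v - {v}) p' ({} \<union> kids v J, {} \<union> {}) ({v @ [c]} \<union> kids v J, {} \<union> {})"
    using insert config_within_black_kids[of J "card J" v] kids_disjoint[of c J v] kids_frame_sub[OF v, of J c]
    by (intro reach_frame[of T "sub (v @ [c])" ?s]) auto
  moreover have "reach T (sub v - {v}) p' ({}, {}) (kids v J, {})"
    using insert by (intro insert.IH) auto
  ultimately show ?case using reach_trans by (fastforce simp: kids_insert)
qed

text \<open>Mirror image of blackening: the first child is the most expensive, being played beside
  \<open>card J - 1\<close> white siblings at cost \<open>p + 1\<close> and then
  \<open>q\<close>.\<close>

lemma reach_remove_white_kids:
  assumes v: "v \<in> nodes T" "Suc (length v) < H" and J: "finite J" "J \<subseteq> {..<d}"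
    and crit: "\<And>c. c < d \<Longrightarrow> critical (v @ [c]) p q r"
    and bound: "J \<noteq> {} \<Longrightarrow> card J + p \<le> p'" "J \<noteq> {} \<Longrightarrow> card J + q \<le> Suc p'"
  shows "reach T (sub v - {v}) p' ({}, kids v J) ({}, {})"
  using J bound
proof (induction J rule: finite_induct)
  case empty
  show ?case by (simp add: kids_def reach_refl config_within_def pebbled_def num_pebbles_def)
next
  case (insert c J)
  let ?s = "p' - card J"
  have c: "c < d" "v @ [c] \<in> nodes T" using insert.prems v child_node by auto
  have "reach T (sub (v @ [c])) ?s ({}, {v @ [c]}) ({}, {})"
    using critical_remove_white[OF crit[OF c(1)] c(2)] insert by force
  then have "reach T (sub v - {v}) p' ({} \<union> {}, {v @ [c]} \<union> kids v J) ({} \<union> {}, {} \<union> kids v J)"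
    using insert config_within_white_kids[of J "card J" v] kids_disjoint[of c J v] kids_frame_sub[OF v, of J c]
    by (intro reach_frame[of T "sub (v @ [c])" ?s]) auto
  moreover have "reach T (sub v - {v}) p' ({}, kids v J) ({}, {})"
    using insert by (intro insert.IH) auto
  ultimately show ?case using reach_trans by (fastforce simp: kids_insert)
qed

lemma reach_place_whites:
  assumes "finite J" "J \<subseteq> S" "J \<inter> pebbled (B, W) = {}" "config_within S q (B, W \<union> J)"
  shows "reach T S q (B, W) (B, W \<union> J)"
  using assms
proof (induction J rule: finite_induct)
  case empty
  then show ?case by (simp add: reach_refl)
next
  case (insert c J)
  have fin: "finite (W \<union> insert c J)" using insert.prems by (simp add: config_within_def pebbled_def)
  then have "card (W \<union> J) \<le> card (W \<union> insert c J)" by (intro card_mono) auto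
  then have n: "config_within S q (B, W \<union> J)"
    using insert.prems by (auto simp: config_within_def pebbled_def num_pebbles_def)
  then have "reach T S q (B, W) (B, W \<union> J)" using insert by (intro insert.IH) auto
  moreover have "reach T S q (B, W \<union> J) (B, insert c (W \<union> J))"
    using n insert by (intro reach_step move_in.place_white) (auto simp: pebbled_def)
  ultimately show ?case using reach_trans by fastforce
qed

text \<open>The two profiles let the middle child follow another strategy than the outer ones. In
  order, the bounds pay for blackening the left children, the ascent in the middle subtree, the
  moment when all \<open>d\<close> children are pebbled, the descent in the middle subtree and the
  removal of the right white pebbles.\<close>

lemma critical_step:
  assumes v: "v \<in> nodes T" "Suc (length v) < H" and d: "d = l + r + 1"
    and crit: "\<And>c. c < d \<Longrightarrow> critical (v @ [c]) p' q' e'"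
    and mid: "critical (v @ [l]) p q e"
    and left: "0 < l \<Longrightarrow> l + p' \<le> Suc P" "0 < l \<Longrightarrow> l + q' \<le> P"
    and P: "l + p \<le> P" "d + e \<le> P"
    and Q: "r + e \<le> Q" "r + q \<le> Q"
    and right: "0 < r \<Longrightarrow> r + p' \<le> Q" "0 < r \<Longrightarrow> r + q' \<le> Suc Q"
  shows "critical v P Q (r + e)"
proof -
  define L where "L = kids v {..<l}"
  define M where "M = v @ [l]"
  define U where "U = kids v {l<..<d}"
  let ?S = "sub v - {v}"
  have Mnode: "M \<in> nodes T" using v d child_node by (simp add: M_def)
  have ch: "children T v = L \<union> {M} \<union> U"
  proof -
    have "children T v = kids v {..<d}" using v by (auto simp: kids_def balanced_tree_def)
    also have "{..<d} = {..<l} \<union> {l} \<union> {l<..<d}" using d by auto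
    finally show ?thesis by (simp add: L_def M_def U_def kids_def image_Un)
  qed
  have cards: "card L = l" "card U = r" "finite L" "finite U"
    using d by (simp_all add: L_def U_def card_kids finite_kids)
  have LU: "L \<inter> U = {}" by (auto simp: L_def U_def kids_def)
  have LM: "sub M \<inter> L = {}" "sub M \<inter> U = {}"
    using kids_disjoint[of l "{..<l}" v] kids_disjoint[of l "{l<..<d}" v]
    by (simp_all add: L_def U_def M_def)
  have sub: "sub M \<union> L \<subseteq> ?S" "sub M \<union> U \<subseteq> ?S"
    unfolding L_def U_def M_def using d by (intro kids_frame_sub[OF v]; auto)+
  obtain B W R where B: "reach T (sub M - {M}) p ({}, {}) (B, W)" "children T M \<subseteq> B \<union> W"
    "R \<subseteq> children T M" "num_pebbles (B - R, W) \<le> e" "reach T (sub M - {M}) q (B - R, W) ({}, {})"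
    using mid by (auto simp: critical_def M_def)
  have BW: "config_within (sub M - {M}) e (B - R, W)"
    using reach_config_within(1)[OF B(5)] B(4) by (simp add: config_within_def)
  have nL: "config_within L l (L, {})" and nU: "config_within U r ({}, U)"
    using cards by (simp_all add: config_within_def pebbled_def num_pebbles_def)
  \<comment> \<open>Cost inside the middle subtree until its root is black: \<open>p\<close> before
    the slide, the leftover \<open>e\<close> and the root after it.\<close>
  let ?s = "max p (Suc e)"
  have s: "?s + l \<le> P" using P d by auto
  have 1: "reach T ?S P ({}, {}) (L, {})"
    unfolding L_def by (rule reach_black_kids[OF v _ _ crit]) (use left d in auto)
  have "reach T (sub M) ?s ({}, {}) (insert M (B - R), W)"
    by (rule reach_black_root[OF Mnode B(1-3) BW]) auto
  then have 2: "reach T ?S P ({} \<union> L, {} \<union> {}) (insert M (B - R) \<union> L, W \<union> {})"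
    by (rule reach_frame[OF _ nL LM(1) sub(1) s])
  have nM: "config_within (sub M) (Suc e) (insert M (B - R), W)"
    using config_within_frame[OF BW config_within_black[of M "{M}"], of "sub M" "Suc e"] self_in_sub[OF Mnode] by auto
  have "config_within (sub M \<union> L) (Suc e + l) (insert M (B - R) \<union> L, W \<union> {})"
    using config_within_frame[OF nM nL LM(1)] by simp
  then have "config_within ?S P (insert M (B - R) \<union> L \<union> {}, W \<union> U)"
    using config_within_frame[OF _ nU, of "sub M \<union> L" "Suc e + l" "(insert M (B - R) \<union> L, W)" ?S P]
      LM LU sub P d by auto
  moreover have "U \<inter> pebbled (insert M (B - R) \<union> L, W) = {}"
    using nM LU LM(2) by (auto simp: config_within_def pebbled_def)
  ultimately have 3: "reach T ?S P (insert M (B - R) \<union> L, W) (insert M (B - R) \<union> L, W \<union> U)"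
    using cards sub by (intro reach_place_whites) auto
  have up: "reach T ?S P ({}, {}) (insert M (B - R) \<union> L, W \<union> U)"
    using reach_trans[OF 1 reach_trans[OF _ 3]] 2 by simp
  \<comment> \<open>All black children, \<open>L\<close> and \<open>M\<close>, slide to
    \<open>v\<close> at once; only the leftover of the middle subtree stays black.\<close>
  have off: "(insert M (B - R) \<union> L) - (L \<union> {M}) = B - R"
    using BW LM by (auto simp: config_within_def pebbled_def)
  have "reach T ?S Q ((B - R) \<union> {}, W \<union> U) ({} \<union> {}, {} \<union> U)"
    using LM sub Q by (intro reach_frame[OF B(5) nU]) auto
  moreover have "reach T ?S Q ({}, U) ({}, {})"
    unfolding U_def by (rule reach_remove_white_kids[OF v _ _ crit]) (use right d in auto)
  ultimately have down: "reach T ?S Q (B - R, W \<union> U) ({}, {})"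
    using reach_trans by fastforce
  have "num_pebbles (B - R, W \<union> U) \<le> r + e"
    using B(4) cards(2) card_Un_le[of W U] unfolding num_pebbles_def fst_conv snd_conv by linarith
  moreover have "children T v \<subseteq> (insert M (B - R) \<union> L) \<union> (W \<union> U)" "L \<union> {M} \<subseteq> children T v"
    unfolding ch by blast+
  ultimately show ?thesis
    unfolding critical_def
    by (intro exI[of _ "insert M (B - R) \<union> L"] exI[of _ "W \<union> U"] exI[of _ "L \<union> {M}"])
      (simp only: off up down simp_thms)
qed

text \<open>The black pebble on the root is removed as soon as it is placed, so it costs one pebble
  on top of \<open>r\<close> but none on top of \<open>q\<close>.\<close>

lemma critical_pebbling:
  assumes "critical [] p q r" "p \<le> s" "q \<le> s" "r < s" "0 < H"
  shows "\<exists>cs. bw_pebbling T (bw_move T) s cs"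
proof -
  have root: "[] \<in> nodes T" "root T = []" using assms(5) by (auto simp: balanced_tree_def)
  obtain B W R where B: "reach T (sub [] - {[]}) p ({}, {}) (B, W)" "children T [] \<subseteq> B \<union> W"
    "R \<subseteq> children T []" "num_pebbles (B - R, W) \<le> r" "reach T (sub [] - {[]}) q (B - R, W) ({}, {})"
    using assms(1) by (auto simp: critical_def)
  have BW: "config_within (sub [] - {[]}) r (B - R, W)"
    using reach_config_within(1)[OF B(5)] B(4) by (simp add: config_within_def)
  have up: "reach T (sub []) s ({}, {}) (insert [] (B - R), W)"
    by (rule reach_black_root[OF root(1) B(1-3) BW assms(4,2)])
  have down: "reach T (sub []) s (B - R, W) ({}, {})"
    using reach_mono[OF B(5)] assms by blast
  have "move_in T (sub []) (insert [] (B - R), W) (insert [] (B - R) - {[]}, W)"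
    using self_in_sub[OF root(1)] by (intro move_in.remove_black) auto
  moreover have "insert [] (B - R) - {[]} = B - R" using BW by (auto simp: config_within_def pebbled_def)
  ultimately have "reach T (sub []) s (insert [] (B - R), W) (B - R, W)"
    using reach_config_within(2)[OF up] reach_config_within(1)[OF down] by (intro reach_step) auto
  then have "reach T (sub []) s (insert [] (B - R), W) ({}, {})" using down by (rule reach_trans)
  then show ?thesis using reach_pebbling[OF up] root sub_nodes by simp
qed

section \<open>Strategies for odd and for even degree\<close>

lemma critical_odd:
  assumes "d = 2 * m + 1" "1 \<le> h" "length v + h = H" "v \<in> nodes T"
  shows "critical v (m * h + 1) (m * h + 1) (m * (h - 1))"
  using assms(2-4)
proof (induction h arbitrary: v rule: nat_induct_at_least)
  case base
  then show ?case using critical_mono[OF critical_leaf[of v]] by simp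
next
  case (Suc h)
  have IH: "critical (v @ [c]) (m * h + 1) (m * h + 1) (m * (h - 1))" if "c < d" for c
    using that Suc child_node by (intro Suc.IH) auto
  have eq: "m * h = m + m * (h - 1)" using Suc.hyps by (cases h) auto
  \<comment> \<open>The moment with all children pebbled is tight:
    \<open>d + m * (h - 1) = m * Suc h + 1\<close>.\<close>
  have "critical v (m * Suc h + 1) (m * Suc h + 1) (m + m * (h - 1))"
    by (rule critical_step[where l = m and r = m, OF _ _ _ IH IH])
      (use Suc assms(1) eq in auto)
  then show ?case by (simp only: eq diff_Suc_1)
qed

text \<open>With \<open>k\<close> children on the left and \<open>k - 1\<close> on the right, the
  middle child must be cheap before its critical time, where it has more siblings beside it, and may
  cost one more afterwards.\<close>

lemma critical_even_from_odd:
  assumes "d = 2 * k" "0 < k" "v \<in> nodes T" "Suc (length v) < H"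
    and "\<And>c. c < d \<Longrightarrow> critical (v @ [c]) (e + k + 1) (e + k) (e + k)"
    and "\<And>c. c < d \<Longrightarrow> critical (v @ [c]) (e + k) (e + k + 1) e"
  shows "critical v (e + 2 * k) (e + 2 * k) (k - 1 + e)"
  by (rule critical_step[where l = k and r = "k - 1", OF assms(3,4) _ assms(5) assms(6)])
    (use assms(1,2) in auto)

text \<open>The two roundings of the split: the extra sibling is black and costs before the critical
  time, or is white and costs after it.\<close>

lemma critical_odd_from_even:
  assumes "d = 2 * k" "0 < k" "v \<in> nodes T" "Suc (length v) < H" "k \<le> e"
    and "\<And>c. c < d \<Longrightarrow> critical (v @ [c]) (e + 1) (e + 1) (e - k)"
  shows "critical v (e + k + 1) (e + k) (e + k)" "critical v (e + k) (e + k + 1) e"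
proof -
  have "critical v (e + k + 1) (e + k) (k - 1 + (e - k))"
    by (rule critical_step[where l = k and r = "k - 1", OF assms(3,4) _ assms(6) assms(6)])
      (use assms(1,2,5) in auto)
  then show "critical v (e + k + 1) (e + k) (e + k)" by (rule critical_mono) (use assms(5) in auto)
  have "critical v (e + k) (e + k + 1) (k + (e - k))"
    by (rule critical_step[where l = "k - 1" and r = k, OF assms(3,4) _ assms(6) assms(6)])
      (use assms(1,2,5) in auto)
  then show "critical v (e + k) (e + k + 1) e" using assms(5) by simp
qed

text \<open>
  At odd heights two strategies are kept, one cheap after and one cheap before the critical time. The
  first serves for the outer children and the second for the middle child of a node of even height.
\<close>

lemma critical_even_odd_height:
  assumes "d = 2 * k" "0 < k" "e = (2 * k - 1) * n" "length v + (2 * n + 1) = H" "v \<in> nodes T"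
  shows "critical v (e + k + 1) (e + k) (e + k) \<and> critical v (e + k) (e + k + 1) e"
  using assms(3-5)
proof (induction n arbitrary: v e)
  case 0
  then show ?case using critical_mono[OF critical_leaf[of v]] by simp
next
  case (Suc n)
  define e' where "e' = (2 * k - 1) * n"
  have e: "e = e' + (2 * k - 1)" by (simp only: Suc.prems(1) e'_def mult_Suc_right add.commute)
  have len: "length v + (2 * n + 3) = H" using Suc.prems(2) by simp
  have node: "v @ [c] \<in> nodes T" if "c < d" for c
    using child_node[of v c] Suc.prems(3) len that by simp
  have "critical (v @ [c]) (e' + 2 * k) (e' + 2 * k) (k - 1 + e')" if c: "c < d" for c
  proof (rule critical_even_from_odd[OF assms(1,2) node[OF c]])
    have len2: "length ((v @ [c]) @ [c']) + (2 * n + 1) = H" for c' using len by simp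
    show "Suc (length (v @ [c])) < H" using len by simp
    fix c' assume "c' < d"
    then have "(v @ [c]) @ [c'] \<in> nodes T"
      using child_node[of "v @ [c]" c'] node[OF c] len by simp
    then show "critical ((v @ [c]) @ [c']) (e' + k + 1) (e' + k) (e' + k)"
      "critical ((v @ [c]) @ [c']) (e' + k) (e' + k + 1) e'"
      using Suc.IH[OF e'_def len2] by blast+
  qed
  \<comment> \<open>Reindexing from \<open>e'\<close> to \<open>e\<close> turns the even-height
    profile of the children into the input of \<open>critical_odd_from_even\<close>.\<close>
  moreover have "e' + 2 * k = e + 1" "k - 1 + e' = e - k" using e assms(2) by auto
  ultimately have "critical (v @ [c]) (e + 1) (e + 1) (e - k)" if "c < d" for c
    using that by metis
  moreover have "k \<le> e" using e assms(2) by simp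
  ultimately show ?case
    using critical_odd_from_even[OF assms(1,2) Suc.prems(3)] len by simp
qed

lemma critical_even_even_height:
  assumes "d = 2 * k" "0 < k" "e = (2 * k - 1) * n" "length v + (2 * n + 2) = H" "v \<in> nodes T"
  shows "critical v (e + 2 * k) (e + 2 * k) (k - 1 + e)"
  by (rule critical_even_from_odd[OF assms(1,2,5)])
    (use assms critical_even_odd_height[OF assms(1-3)] child_node in auto)

end

section \<open>From plays to pebbling numbers\<close>

lemma BWpebbles_le:
  "\<exists>cs. bw_pebbling S (bw_move S) p cs \<Longrightarrow> BWpebbles S \<le> p"
  unfolding BWpebbles_def by (rule Least_le)

text \<open>Every pebbling remains one when slides are allowed. For odd \<open>d\<close> it thus
  suffices to bound from below with slides and from above without them.\<close>

lemma BWpebbles_ws_le_BWpebbles: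
  assumes "1 \<le> h"
  shows "BWpebbles_ws (balanced_tree d h) \<le> BWpebbles (balanced_tree d h)"
proof -
  let ?S = "balanced_tree d h"
  obtain cs where "bw_pebbling ?S (bw_move ?S) (BWpebbles ?S) cs"
    using LeastI_ex[OF bw_pebbling_exists[OF assms]] unfolding BWpebbles_def by blast
  then have "bw_pebbling ?S (bw_move_ws ?S) (BWpebbles ?S) cs"
    unfolding bw_pebbling_def by (auto simp: bw_move_ws_def elim: successively_mono)
  then show ?thesis unfolding BWpebbles_ws_def by (intro Least_le) blast
qed

lemma BWpebbles_odd_le:
  assumes "d = 2 * m + 1" "1 \<le> h"
  shows "BWpebbles (balanced_tree d h) \<le> m * h + 1"
proof -
  interpret tree d h .
  have "[] \<in> nodes T" using assms(2) by (simp add: balanced_tree_def)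
  then have "critical [] (m * h + 1) (m * h + 1) (m * (h - 1))"
    using critical_odd[OF assms(1,2)] by simp
  moreover have "m * (h - 1) < m * h + 1" by (simp add: le_imp_less_Suc)
  ultimately show ?thesis
    using assms(2) by (intro BWpebbles_le critical_pebbling[where r = "m * (h - 1)"]) auto
qed

lemma BWpebbles_even_le:
  assumes "d = 2 * k" "0 < k" "1 \<le> h"
  shows "BWpebbles (balanced_tree d h) \<le> ((2 * k - 1) * h + 1) div 2 + 1"
proof -
  interpret tree d h .
  have root: "[] \<in> nodes T" using assms(3) by (simp add: balanced_tree_def)
  \<comment> \<open>The index \<open>j\<close> expresses \<open>2 * k - 1\<close> without truncated
    subtraction.\<close>
  obtain j where j: "2 * k - 1 = 2 * j + 1" "k = j + 1" using assms(2) by (cases k) auto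
  show ?thesis
  proof (cases "odd h")
    case True
    then obtain n where n: "h = 2 * n + 1" by (auto elim: oddE)
    define e where "e = (2 * k - 1) * n"
    have "critical [] (e + k) (e + k + 1) e"
      using critical_even_odd_height[OF assms(1,2) e_def] n root by simp
    then have "BWpebbles T \<le> e + k + 1"
      by (intro BWpebbles_le critical_pebbling) (use assms(2,3) in auto)
    moreover have "(2 * k - 1) * h + 1 = 2 * (e + k)"
      unfolding e_def n j by (simp add: algebra_simps)
    ultimately show ?thesis by simp
  next
    case False
    then obtain n' where "h = 2 * n'" by (auto elim: evenE)
    then obtain n where n: "h = 2 * n + 2" using assms(3) by (cases n') auto
    define e where "e = (2 * k - 1) * n"
    have "critical [] (e + 2 * k) (e + 2 * k) (k - 1 + e)"
      using critical_even_even_height[OF assms(1,2) e_def] n root by simp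
    then have "BWpebbles T \<le> e + 2 * k"
      by (intro BWpebbles_le critical_pebbling) (use assms(2,3) in auto)
    moreover have "(2 * k - 1) * h + 1 = 2 * (e + 2 * k - 1) + 1"
      unfolding e_def n j by (simp add: algebra_simps)
    ultimately show ?thesis using assms(2) by simp
  qed
qed

lemma pebbling_time:
  assumes "bw_pebbling (balanced_tree d h) move p cs"
  obtains t N where "t \<le> N" "[] \<in> pebbled (cs ! t)"
    "pebbled (cs ! 0) = {}" "pebbled (cs ! N) = {}"
    "\<And>k. k \<le> N \<Longrightarrow> finite (pebbled (cs ! k)) \<and> num_pebbles (cs ! k) \<le> p"
    "\<And>k. k < N \<Longrightarrow> move (cs ! k) (cs ! Suc k)"
proof -
  let ?S = "balanced_tree d h"
  define N where "N = length cs - 1"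
  have cs: "cs \<noteq> []" "hd cs = ({}, {})" "last cs = ({}, {})" "successively move cs"
    "\<exists>C\<in>set cs. root ?S \<in> fst C" "\<forall>C\<in>set cs. is_bw_config ?S C \<and> num_pebbles C \<le> p"
    using assms by (auto simp: bw_pebbling_def)
  have N: "Suc N = length cs" using cs(1) by (simp add: N_def)
  obtain t where "t < length cs" "root ?S \<in> fst (cs ! t)" using cs(5) by (metis in_set_conv_nth)
  then have "t \<le> N" "[] \<in> pebbled (cs ! t)" using N by (auto simp: balanced_tree_def pebbled_def)
  moreover have "finite (pebbled (cs ! k)) \<and> num_pebbles (cs ! k) \<le> p" if "k \<le> N" for k
  proof -
    have "cs ! k \<in> set cs" using that N by simp
    then show ?thesis
      using cs(6) finite_subset[OF _ finite_nodes_balanced_tree]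
      by (auto simp: is_bw_config_def pebbled_def)
  qed
  moreover have "move (cs ! k) (cs ! Suc k)" if "k < N" for k
    using cs(4) that N by (auto simp: successively_conv_nth)
  ultimately show thesis
    using that[of t N] N cs(1-3) by (simp add: hd_conv_nth last_conv_nth N_def pebbled_def)
qed

lemma load_le_num_pebbles: "finite (pebbled C) \<Longrightarrow> load C v \<le> num_pebbles C"
  unfolding load_def num_pebbles_def pebbled_def
  by (meson card_Un_le card_mono inf_le1 le_trans)

lemma (in ws_play) forces_root:
  assumes "forces [] q" "t \<le> N" "[] \<in> pebbled (f t)" "pebbled (f 0) = {}" "pebbled (f N) = {}"
    and "\<And>k. k \<le> N \<Longrightarrow> num_pebbles (f k) \<le> p"
  shows "q \<le> p"
proof -
  have "\<exists>k\<in>{0..N}. q \<le> load (f k) []"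
    using assms(1)[unfolded forces_def, rule_format, of 0 t N] assms(2-5) by (simp add: idle_def)
  then obtain k where "k \<le> N" "q \<le> load (f k) []" by auto
  then show ?thesis
    using assms(6)[of k] load_le_num_pebbles[OF finite_pebbled, of k "[]"] by linarith
qed

lemma BWpebbles_ws_odd_ge:
  assumes "d = 2 * m + 1" "2 \<le> h"
  shows "m * h + 1 \<le> BWpebbles_ws (balanced_tree d h)"
proof -
  let ?S = "balanced_tree d h"
  obtain cs where "bw_pebbling ?S (bw_move_ws ?S) (BWpebbles_ws ?S) cs"
    using LeastI_ex[OF bw_pebbling_ws_exists[of h d]] assms(2) unfolding BWpebbles_ws_def by auto
  then obtain t N where t: "t \<le> N" "[] \<in> pebbled (cs ! t)" "pebbled (cs ! 0) = {}"
    "pebbled (cs ! N) = {}"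
    "\<And>k. k \<le> N \<Longrightarrow> finite (pebbled (cs ! k)) \<and> num_pebbles (cs ! k) \<le> BWpebbles_ws ?S"
    "\<And>k. k < N \<Longrightarrow> bw_move_ws ?S (cs ! k) (cs ! Suc k)"
    by (rule pebbling_time) blast
  \<comment> \<open>The play is frozen after time \<open>N\<close>, so that every \<open>f k\<close>
    is a configuration of the list and hence finite.\<close>
  define f where "f k = cs ! min k N" for k
  interpret ws_play f N d h
    by unfold_locales (use t in \<open>auto simp: f_def min_def\<close>)
  have "forces [] (m * h + 1)" using forces_odd[OF assms] by simp
  then show ?thesis by (rule forces_root[of _ t]) (use t in \<open>auto simp: f_def\<close>)
qed

lemma BWpebbles_binary_ge:
  assumes "2 \<le> h"
  shows "Suc h div 2 + 1 \<le> BWpebbles (balanced_tree 2 h)"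
proof -
  let ?S = "balanced_tree 2 h"
  obtain cs where "bw_pebbling ?S (bw_move ?S) (BWpebbles ?S) cs"
    using LeastI_ex[OF bw_pebbling_exists[of h 2]] assms unfolding BWpebbles_def by auto
  then obtain t N where t: "t \<le> N" "[] \<in> pebbled (cs ! t)" "pebbled (cs ! 0) = {}"
    "pebbled (cs ! N) = {}"
    "\<And>k. k \<le> N \<Longrightarrow> finite (pebbled (cs ! k)) \<and> num_pebbles (cs ! k) \<le> BWpebbles ?S"
    "\<And>k. k < N \<Longrightarrow> bw_move ?S (cs ! k) (cs ! Suc k)"
    by (rule pebbling_time) blast
  define f where "f k = cs ! min k N" for k
  interpret play f N 2 h
    by unfold_locales (use t in \<open>auto simp: f_def min_def bw_move_ws_def\<close>)
  have "forces [] (Suc h div 2 + 1)" using forces_binary[OF assms] by simp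
  then show ?thesis by (rule forces_root[of _ t]) (use t in \<open>auto simp: f_def\<close>)
qed

lemma ceiling_half: "\<lceil>real n / 2\<rceil> = int ((n + 1) div 2)"
  by linarith

theorem theorem4p2:
  fixes d h :: nat
  assumes "h \<ge> 2"
  shows "(d = 2 \<or> (odd d \<and> d \<ge> 3) \<longrightarrow>
            int (BWpebbles (balanced_tree d h)) = \<lceil>(real d - 1) * real h / 2\<rceil> + 1) \<and>
         (odd d \<and> d \<ge> 3 \<longrightarrow>
            int (BWpebbles_ws (balanced_tree d h)) = \<lceil>(real d - 1) * real h / 2\<rceil> + 1) \<and>
         (even d \<and> d \<ge> 2 \<longrightarrow>
            int (BWpebbles (balanced_tree d h)) \<le> \<lceil>(real d - 1) * real h / 2\<rceil> + 1)"
proof -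
  let ?v = "\<lceil>(real d - 1) * real h / 2\<rceil> + 1"
  have odd: "int (BWpebbles (balanced_tree d h)) = ?v \<and> int (BWpebbles_ws (balanced_tree d h)) = ?v"
    if "odd d" "d \<ge> 3"
  proof -
    obtain m where m: "d = 2 * m + 1" using \<open>odd d\<close> by (auto elim: oddE)
    have "(real d - 1) * real h / 2 = real (m * h)" using m by simp
    then have "?v = int (m * h + 1)" by (simp only: ceiling_of_nat of_nat_add of_nat_1)
    moreover have "BWpebbles (balanced_tree d h) \<le> m * h + 1"
      using BWpebbles_odd_le[OF m] assms by simp
    \<comment> \<open>Both numbers are squeezed: the bound with slides is \<open>m * h + 1\<close>
      from below, the one without is the same from above.\<close>
    ultimately show ?thesis
      using BWpebbles_ws_odd_ge[OF m assms] BWpebbles_ws_le_BWpebbles[of h d] assms by linarith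
  qed
  have even: "int (BWpebbles (balanced_tree d h)) \<le> ?v" if "even d" "d \<ge> 2"
  proof -
    obtain k where k: "d = 2 * k" using \<open>even d\<close> by (auto elim: evenE)
    have "(real d - 1) * real h / 2 = real ((2 * k - 1) * h) / 2" using k that by (simp add: of_nat_diff)
    then have "?v = int (((2 * k - 1) * h + 1) div 2 + 1)"
      by (simp only: ceiling_half of_nat_add of_nat_1)
    moreover have "BWpebbles (balanced_tree d h) \<le> ((2 * k - 1) * h + 1) div 2 + 1"
      using BWpebbles_even_le[OF k] k \<open>d \<ge> 2\<close> assms by simp
    ultimately show ?thesis by linarith
  qed
  have "?v \<le> int (BWpebbles (balanced_tree d h))" if "d = 2"
    using BWpebbles_binary_ge[OF assms] ceiling_half[of h] that by simp
  then show ?thesis using odd even by force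
qed

end
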